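(* Let $G$ be a finite group and let $S\subseteq G$ be a subset that is normal ($g^{-1}sg\in S$ for all $s\in S$, $g\in G$) and symmetric ($S=S^{-1}$). If the order of every element of $S$ belongs to $\{2,3,4,6\}$, then the Cayley graph $\mathrm{Cay}(G,S)$ is integral, i.e. every eigenvalue of its adjacency matrix is an integer.
   Context: All groups and graphs are finite. For a group $G$ and a subset $S\subseteq G$ with $1\notin S$ and $S=S^{-1}$, where $S^{-1}=\{s^{-1}\mid s\in S\}$, the Cayley graph $\mathrm{Cay}(G,S)$ is the undirected loopless graph with vertex set $G$ and edge set $\{(g,gs)\mid g\in G,\ s\in S\}$. Its adjacency matrix is the complex matrix $(a_{g,h})$ with rows and columns indexed by $G$, where $a_{g,h}=1$ if $(g,h)$ is an edge and $a_{g,h}=0$ otherwise. *)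

theory Defs
  imports
    "HOL-Algebra.Multiplicative_Group"
    "Graph_Theory.Pair_Digraph"
    "Jordan_Normal_Form.Char_Poly"
begin

(* As usual in Graph_Theory, an undirected loopless graph is a symmetric loop-free digraph. *)

definition cayley_graph :: "('a, 'b) monoid_scheme \<Rightarrow> 'a set \<Rightarrow> 'a pair_pre_digraph" where
  "cayley_graph G S =
     \<lparr>pverts = carrier G, parcs = {(g, g \<otimes>\<^bsub>G\<^esub> s) | g s. g \<in> carrier G \<and> s \<in> S}\<rparr>"

lemma (in group) pair_graph_cayley_graph:
  assumes fin: "finite (carrier G)"
    and S: "S \<subseteq> carrier G" "\<one> \<notin> S" and inv_S: "set_inv S = S"
  shows "pair_graph (cayley_graph G S)"
proof -
  let ?E = "cayley_graph G S"
  have sub: "parcs ?E \<subseteq> carrier G \<times> carrier G"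
    using S(1) by (auto simp: cayley_graph_def)
  have finE: "finite (parcs ?E)"
    using finite_subset[OF sub] fin by blast
  have "(h, g) \<in> parcs ?E" if gh: "(g, h) \<in> parcs ?E" for g h
  proof -
    from gh obtain s where s: "g \<in> carrier G" "s \<in> S" "h = g \<otimes> s"
      unfolding cayley_graph_def by auto
    have sc: "s \<in> carrier G"
      using s(2) S(1) by blast
    have "inv s \<in> set_inv S"
      using s(2) unfolding SET_INV_def by blast
    then have "inv s \<in> S"
      unfolding inv_S .
    moreover have "h \<in> carrier G" "g = h \<otimes> inv s"
      using s sc by (simp_all add: m_assoc)
    ultimately show ?thesis
      unfolding cayley_graph_def by auto
  qed
  then have symE: "symmetric (with_proj ?E)"
    unfolding symmetric_def with_proj_simps by (intro symI)
  have loop: "fst e \<noteq> snd e" if e: "e \<in> parcs ?E" for e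
  proof -
    from e obtain g s where gs: "g \<in> carrier G" "s \<in> S" "e = (g, g \<otimes> s)"
      unfolding cayley_graph_def by auto
    have "s \<in> carrier G" "s \<noteq> \<one>"
      using gs(2) S by blast+
    then show ?thesis
      using gs(1,3) by simp
  qed
  have verts: "pverts ?E = carrier G"
    by (simp add: cayley_graph_def)
  show ?thesis
  proof unfold_locales
    show "fst e \<in> pverts ?E" "snd e \<in> pverts ?E" if "e \<in> parcs ?E" for e
      using that sub unfolding verts by auto
    show "finite (pverts ?E)"
      unfolding verts by (rule fin)
    show "fst e \<noteq> snd e" if "e \<in> parcs ?E" for e
      using that by (rule loop)
  qed (fact finE symE)+
qed

(* Matrices are indexed by natural numbers, so the rows and columns are labelled by the
   vertices via a list vs enumerating each vertex exactly once. *)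

definition adjacency_matrix :: "'a list \<Rightarrow> 'a pair_pre_digraph \<Rightarrow> complex mat" where
  "adjacency_matrix vs E =
     mat (length vs) (length vs) (\<lambda>(i, j). if (vs ! i, vs ! j) \<in> parcs E then 1 else 0)"

(* Different enumerations give matrices conjugate under a permutation matrix, so quantifying
   over all of them is immaterial; finiteness guarantees that there is one. *)

definition integral_graph :: "'a pair_pre_digraph \<Rightarrow> bool" where
  "integral_graph E \<longleftrightarrow> finite (pverts E) \<and>
     (\<forall>vs. distinct vs \<and> set vs = pverts E \<longrightarrow>
       (\<forall>k. eigenvalue (adjacency_matrix vs E) k \<longrightarrow> k \<in> \<int>))"

end

(* Because S is normal, the eigenspace V of the adjacency matrix for an eigenvalue k is invariant
   under every right translation R_t, and the R_s with s in S add up to k on V. Taking traces,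
   2 k dim V is the sum over s in S of the traces of R_s + R_(s^-1) on V. If s has order 2, 3, 4
   or 6, every eigenvalue of R_s + R_(s^-1) has the form z + 1/z for a root of unity z of that
   order, hence is an integer. So k is rational; being an algebraic integer, it is an integer. *)

theory Submission
  imports Defs "Jordan_Normal_Form.Schur_Decomposition" "HOL-Library.Function_Algebras"
begin

section \<open>Traces and eigenvalues of matrices\<close>

lemma trace_mult_comm:
  fixes A B :: "'a :: comm_semiring_0 mat"
  assumes "A \<in> carrier_mat n m" and "B \<in> carrier_mat m n"
  shows "(\<Sum>i<n. (A * B) $$ (i, i)) = (\<Sum>i<m. (B * A) $$ (i, i))"
proof -
  have "(\<Sum>i<n. (A * B) $$ (i, i)) = (\<Sum>i<n. \<Sum>j<m. A $$ (i, j) * B $$ (j, i))"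
    using assms by (intro sum.cong) (auto simp: scalar_prod_def lessThan_atLeast0)
  also have "\<dots> = (\<Sum>j<m. \<Sum>i<n. B $$ (j, i) * A $$ (i, j))"
    by (subst sum.swap) (simp add: mult.commute)
  also have "\<dots> = (\<Sum>i<m. (B * A) $$ (i, i))"
    using assms by (intro sum.cong) (auto simp: scalar_prod_def lessThan_atLeast0)
  finally show ?thesis .
qed

text \<open>Schur decomposition makes \<open>A\<close> similar to a matrix \<open>B\<close> whose
  diagonal lists the roots of the characteristic polynomial, and similar matrices have the same
  trace.\<close>

lemma trace_in_Ints_if_eigenvalues_in_Ints:
  fixes A :: "complex mat"
  assumes A: "A \<in> carrier_mat n n" and ev: "\<And>k. eigenvalue A k \<Longrightarrow> k \<in> \<int>"
  shows "(\<Sum>i<n. A $$ (i, i)) \<in> \<int>"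
proof -
  obtain es where es: "char_poly A = (\<Prod>e\<leftarrow>es. [:- e, 1:])"
    using char_poly_factorized[OF A] by blast
  obtain B P Q where "schur_decomposition A es = (B, P, Q)"
    by (cases "schur_decomposition A es")
  then have wit: "similar_mat_wit A B P Q" and diag: "diag_mat B = es"
    using schur_decomposition[OF A es] by auto
  note w = similar_mat_witD2[OF A wit]
  have "(\<Sum>i<n. A $$ (i, i)) = (\<Sum>i<n. (P * (B * Q)) $$ (i, i))"
    unfolding w(3) using w(5-7) by (simp add: assoc_mult_mat[of P n n B n Q n])
  \<comment> \<open>Cyclicity of the trace moves \<open>P\<close> to the right end, where it cancels
    against \<open>Q\<close>.\<close>
  also have "\<dots> = (\<Sum>i<n. (B * Q * P) $$ (i, i))"
    using w by (intro trace_mult_comm) auto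
  also have "B * Q * P = B"
    using w(2,5-7) by (simp add: assoc_mult_mat[of B n n Q n P n])
  also have "(\<Sum>i<n. B $$ (i, i)) \<in> \<int>"
  proof (intro Ints_sum)
    fix i assume "i \<in> {..<n}"
    then have "B $$ (i, i) \<in> set es"
      using w(5) by (auto simp: diag_mat_def simp flip: diag)
    then have "poly (char_poly A) (B $$ (i, i)) = 0"
      unfolding es by (induction es) auto
    then show "B $$ (i, i) \<in> \<int>"
      using ev eigenvalue_root_char_poly[OF A] by blast
  qed
  finally show ?thesis .
qed

text \<open>Lifting the entries to integers shows that the characteristic polynomial is a monic
  integer polynomial; \<open>k\<close> is one of its roots.\<close>

lemma algebraic_int_eigenvalue:
  fixes A :: "'a :: field_char_0 mat"
  assumes A: "A \<in> carrier_mat n n"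
    and ints: "\<And>i j. i < n \<Longrightarrow> j < n \<Longrightarrow> A $$ (i, j) \<in> \<int>"
    and k: "eigenvalue A k"
  shows "algebraic_int k"
proof -
  have "\<forall>p\<in>{..<n} \<times> {..<n}. \<exists>z. A $$ p = of_int z"
    using ints by (auto elim!: Ints_cases)
  then obtain z where z: "\<forall>p\<in>{..<n} \<times> {..<n}. A $$ p = of_int (z p)"
    by (rule bchoice[THEN exE])
  define Z where "Z = mat n n z"
  have Z: "Z \<in> carrier_mat n n"
    by (simp add: Z_def)
  have "A = map_mat of_int Z"
    using A z by (intro eq_matI) (auto simp: Z_def)
  then have "char_poly A = map_poly of_int (char_poly Z)"
    using of_int_hom.char_poly_hom[OF Z] by simp
  moreover have "lead_coeff (char_poly Z) = 1"
    using degree_monic_char_poly[OF Z] by simp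
  ultimately show ?thesis
    using k eigenvalue_root_char_poly[OF A] algebraic_int_altdef_ipoly by metis
qed

section \<open>Traces of linear maps on finite-dimensional subspaces\<close>

text \<open>The scalars are fixed to be complex because the trace argument needs characteristic
  polynomials that split into linear factors.\<close>

locale complex_vector_space = vector_space scale
  for scale :: "complex \<Rightarrow> 'b :: ab_group_add \<Rightarrow> 'b" (infixr \<open>*s\<close> 75)
begin

text \<open>The sum is the trace of \<open>T\<close> restricted to the invariant subspace
  \<open>span B\<close>. An eigenvector of the matrix of \<open>T\<close> in the basis
  \<open>B\<close> is the coordinate vector of an eigenvector of \<open>T\<close>, so the matrix
  result applies.\<close>

lemma trace_on_span_in_Ints:
  assumes B: "independent B" "finite B"
    and T: "Vector_Spaces.linear scale scale T" "\<And>b. b \<in> B \<Longrightarrow> T b \<in> span B"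
    and ev: "\<And>v k. v \<in> span B \<Longrightarrow> v \<noteq> 0 \<Longrightarrow> T v = k *s v \<Longrightarrow> k \<in> \<int>"
  shows "(\<Sum>b\<in>B. representation B (T b) b) \<in> \<int>"
proof -
  interpret T: Vector_Spaces.linear scale scale T by (rule T)
  obtain bs where bs: "set bs = B" "distinct bs"
    using finite_distinct_list[OF B(2)] by blast
  define n where "n = length bs"
  have bij: "bij_betw ((!) bs) {..<n} B"
    using bs by (auto simp: n_def intro: bij_betw_nth)
  have mem: "bs ! i \<in> B" if "i < n" for i
    using that bs by (auto simp: n_def)
  define M where "M = mat n n (\<lambda>(i, j). representation B (T (bs ! j)) (bs ! i))"
  have M: "M \<in> carrier_mat n n"
    by (simp add: M_def)
  have Tb: "T (bs ! j) = (\<Sum>i<n. M $$ (i, j) *s bs ! i)" if "j < n" for j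
  proof -
    have "(\<Sum>b\<in>B. representation B (T (bs ! j)) b *s b) = T (bs ! j)"
      using B T(2) mem[OF that] by (intro sum_representation_eq) auto
    then show ?thesis
      using that by (simp add: M_def sum.reindex_bij_betw[OF bij, symmetric])
  qed
  have "k \<in> \<int>" if k: "eigenvalue M k" for k
  proof -
    obtain x where x: "x \<in> carrier_vec n" "x \<noteq> 0\<^sub>v n" "M *\<^sub>v x = k \<cdot>\<^sub>v x"
      using k M by (auto simp: eigenvalue_def eigenvector_def)
    define v where "v = (\<Sum>j<n. x $ j *s bs ! j)"
    have "v \<in> span B"
      unfolding v_def by (intro span_sum span_scale span_base) (auto simp: mem)
    moreover have "v \<noteq> 0"
    proof
      assume "v = 0"
      \<comment> \<open>The coordinates \<open>x\<close>, reindexed by basis vectors instead of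
        positions so that independence of \<open>B\<close> applies.\<close>
      define u where "u b = x $ the_inv_into {..<n} ((!) bs) b" for b
      have u: "u (bs ! j) = x $ j" if "j < n" for j
        using that bij by (simp add: u_def bij_betw_def the_inv_into_f_f)
      have "(\<Sum>b\<in>B. u b *s b) = v"
        by (simp add: v_def u sum.reindex_bij_betw[OF bij, symmetric])
      then have "\<forall>b\<in>B. u b = 0"
        using B \<open>v = 0\<close> independent_explicit_finite_subsets by blast
      then have "x = 0\<^sub>v n"
        using x(1) u mem by (intro eq_vecI) force+
      then show False
        using x(2) by contradiction
    qed
    moreover have "T v = k *s v"
    proof -
      have Mx: "(\<Sum>j<n. x $ j * M $$ (i, j)) = k * x $ i" if "i < n" for i
      proof -
        have "(M *\<^sub>v x) $ i = (\<Sum>j<n. x $ j * M $$ (i, j))"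
          using that x(1) M by (auto simp: scalar_prod_def lessThan_atLeast0 mult.commute intro!: sum.cong)
        then show ?thesis
          using that x by simp
      qed
      have "T v = (\<Sum>j<n. x $ j *s (\<Sum>i<n. M $$ (i, j) *s bs ! i))"
        unfolding v_def T.sum T.scale using Tb by simp
      also have "\<dots> = (\<Sum>i<n. (\<Sum>j<n. x $ j * M $$ (i, j)) *s bs ! i)"
        unfolding scale_sum_right scale_sum_left scale_scale by (rule sum.swap)
      also have "\<dots> = k *s v"
        by (simp add: Mx v_def scale_sum_right)
      finally show ?thesis .
    qed
    ultimately show ?thesis
      using ev by blast
  qed
  then have "(\<Sum>i<n. M $$ (i, i)) \<in> \<int>"
    by (rule trace_in_Ints_if_eigenvalues_in_Ints[OF M])
  then show ?thesis
    by (simp add: M_def sum.reindex_bij_betw[OF bij, symmetric])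
qed

end

section \<open>Periodic solutions of a three-term recurrence\<close>

text \<open>The eigenvalue equations of a cycle of length 2, each neighbour counted twice;
  eliminating \<open>y\<close> gives \<open>c * c * x = 4 * x\<close>.\<close>

lemma double_eq_cases:
  fixes x y c :: complex
  assumes "y + y = c * x" "x + x = c * y" "x \<noteq> 0"
  shows "c = 2 \<or> c = -2"
proof -
  have "c * (c * x) = c * y + c * y"
    by (simp add: distrib_left flip: assms(1))
  then have "(c - 2) * (c + 2) * x = 0"
    by (simp add: algebra_simps flip: assms(2))
  then show ?thesis
    using assms(3) by (auto simp: eq_neg_iff_add_eq_0)
qed

text \<open>The eigenvalue equations of a triangle; eliminating \<open>y\<close> and
  \<open>z\<close> gives \<open>c * c * x = c * x + 2 * x\<close>.\<close>

lemma triple_eq_cases: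
  fixes x y z c :: complex
  assumes "y + z = c * x" "x + z = c * y" "x + y = c * z" "x \<noteq> 0"
  shows "c = 2 \<or> c = -1"
proof -
  have "c * (c * x) = c * y + c * z"
    by (simp add: distrib_left flip: assms(1))
  also have "\<dots> = c * x + 2 * x"
    by (simp flip: assms(1-3))
  finally have "(c - 2) * (c + 1) * x = 0"
    by (simp add: algebra_simps)
  then show ?thesis
    using assms(4) by (auto simp: eq_neg_iff_add_eq_0)
qed

text \<open>The model solution is \<open>a i = z ^ i\<close> with \<open>z ^ n = 1\<close> and
  \<open>k = z + 1/z\<close>. Periodicity closes the recurrence into a cyclic linear system, and
  \<open>a 0 \<noteq> 0\<close> excludes its trivial solution.\<close>

lemma periodic_recurrence_in_Ints:
  fixes a :: "nat \<Rightarrow> complex"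
  assumes n: "n \<in> {2, 3, 4, 6}" and per: "\<And>i. a (i + n) = a i"
    and rec: "\<And>i. a (Suc (Suc i)) + a i = k * a (Suc i)" and a0: "a 0 \<noteq> 0"
  shows "k \<in> \<int>"
proof -
  \<comment> \<open>Passing from \<open>z + 1/z\<close> to \<open>z\<^sup>2 + 1/z\<^sup>2\<close> halves the periods 4 and 6.\<close>
  have rec2: "a (Suc (Suc (Suc (Suc i)))) + a i = (k * k - 2) * a (Suc (Suc i))" for i
  proof -
    have "k * (k * a (Suc (Suc i))) = k * a (Suc (Suc (Suc i))) + k * a (Suc i)"
      by (simp add: distrib_left flip: rec)
    also have "\<dots> = a (Suc (Suc (Suc (Suc i)))) + 2 * a (Suc (Suc i)) + a i"
      by (simp flip: rec)
    finally show ?thesis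
      by (simp add: algebra_simps)
  qed
  consider "n = 2" | "n = 3" | "n = 4" | "n = 6"
    using n by auto
  then show ?thesis
  proof cases
    case 1
    then have "k = 2 \<or> k = -2"
      using rec[of 0] rec[of 1] per[of 0] per[of 1] a0
      by (intro double_eq_cases[of "a 1" k "a 0"]) (simp_all add: numeral_eq_Suc)
    then show ?thesis by auto
  next
    case 2
    then have "k = 2 \<or> k = -1"
      using rec[of 0] rec[of 1] rec[of 2] per[of 0] per[of 1] a0
      by (intro triple_eq_cases[of "a 1" "a 2" k "a 0"]) (simp_all add: numeral_eq_Suc add.commute)
    then show ?thesis by auto
  next
    case 3
    then have "k * k - 2 = 2 \<or> k * k - 2 = -2"
      using rec2[of 0] rec2[of 2] per[of 0] per[of 2] a0
      by (intro double_eq_cases[of "a 2" _ "a 0"]) (simp_all add: numeral_eq_Suc)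
    then have "(k - 2) * (k + 2) = 0 \<or> k = 0"
      by (auto simp: algebra_simps)
    then show ?thesis
      by (auto simp: add_eq_0_iff2)
  next
    case 4
    then have "k * k - 2 = 2 \<or> k * k - 2 = -1"
      using rec2[of 0] rec2[of 2] rec2[of 4] per[of 0] per[of 2] a0
      by (intro triple_eq_cases[of "a 2" "a 4" _ "a 0"]) (simp_all add: numeral_eq_Suc add.commute)
    then have "(k - 2) * (k + 2) = 0 \<or> (k - 1) * (k + 1) = 0"
      by (auto simp: algebra_simps)
    then show ?thesis
      by (auto simp: add_eq_0_iff2)
  qed
qed

section \<open>The vector space of complex functions\<close>

interpretation fun_space: complex_vector_space "\<lambda>c (f :: 'a \<Rightarrow> complex) x. c * f x"
  by unfold_locales (auto simp: fun_eq_iff algebra_simps)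

lemma sum_fun_apply: "(\<Sum>i\<in>I. F i) x = (\<Sum>i\<in>I. F i x)"
  for F :: "'i \<Rightarrow> 'a \<Rightarrow> 'b :: comm_monoid_add"
  by (induction I rule: infinite_finite_induct) auto

text \<open>Point indicators span these functions. This bounds the dimension even when the
  underlying type is infinite.\<close>

lemma finitely_supported_subset_span:
  assumes "finite A"
  shows "{f. \<forall>x. x \<notin> A \<longrightarrow> f x = 0} \<subseteq> fun_space.span ((\<lambda>a x. if x = a then 1 else 0) ` A)"
    (is "_ \<subseteq> fun_space.span (?\<delta> ` A)")
proof
  fix f :: "'a \<Rightarrow> complex" assume "f \<in> {f. \<forall>x. x \<notin> A \<longrightarrow> f x = 0}"
  then have "f = (\<Sum>a\<in>A. (\<lambda>x. f a * ?\<delta> a x))"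
    using assms by (auto simp: fun_eq_iff sum_fun_apply if_distrib cong: if_cong)
  also have "\<dots> \<in> fun_space.span (?\<delta> ` A)"
    by (intro fun_space.span_sum fun_space.span_scale fun_space.span_base) auto
  finally show "f \<in> fun_space.span (?\<delta> ` A)" .
qed

section \<open>Right translations of functions on a group\<close>

context group
begin

text \<open>Functions on the group are encoded as functions vanishing off the carrier; the default
  value 0 keeps translates in that space.\<close>

definition right_translation :: "'a \<Rightarrow> ('a \<Rightarrow> complex) \<Rightarrow> 'a \<Rightarrow> complex" where
  "right_translation t f = (\<lambda>g. if g \<in> carrier G then f (g \<otimes> t) else 0)"

text \<open>Along a coset of the cyclic group generated by \<open>t\<close>, the values
  \<open>f (g \<otimes> t [^] i)\<close> have period \<open>ord t\<close>, and the eigenvalue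
  equation becomes the three-term recurrence. Choosing \<open>g\<close> with
  \<open>f g \<noteq> 0\<close> makes the initial term nonzero.\<close>

lemma eigenvalue_right_translation_add_inv_in_Ints:
  assumes t: "t \<in> carrier G" "ord t \<in> {2, 3, 4, 6}"
    and supp: "\<forall>x. x \<notin> carrier G \<longrightarrow> f x = 0" and "f \<noteq> 0"
    and ev: "right_translation t f + right_translation (inv t) f = (\<lambda>x. k * f x)"
  shows "k \<in> \<int>"
proof -
  obtain g where g: "g \<in> carrier G" "f g \<noteq> 0"
    using supp \<open>f \<noteq> 0\<close> by (auto simp: fun_eq_iff)
  define a where "a i = f (g \<otimes> t [^] i)" for i :: nat
  have "a (i + ord t) = a i" for i
    using t by (simp add: a_def nat_pow_mult[symmetric])
  moreover have "a (Suc (Suc i)) + a i = k * a (Suc i)" for i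
  proof -
    have "g \<otimes> t [^] Suc i \<in> carrier G"
      using g t by simp
    then have "f (g \<otimes> t [^] Suc i \<otimes> t) + f (g \<otimes> t [^] Suc i \<otimes> inv t) = k * f (g \<otimes> t [^] Suc i)"
      using fun_cong[OF ev, of "g \<otimes> t [^] Suc i"] by (simp add: right_translation_def)
    then show ?thesis
      using g t by (simp add: a_def m_assoc)
  qed
  moreover have "a 0 \<noteq> 0"
    using g by (simp add: a_def)
  ultimately show ?thesis
    using periodic_recurrence_in_Ints t(2) by blast
qed

section \<open>Rationality of the eigenvalues\<close>

text \<open>Phrased for functions instead of vectors, so that translations act without an
  enumeration of the group.\<close>

lemma convolution_eigenvalue_in_Rats:
  fixes f :: "'a \<Rightarrow> complex"
  assumes fin: "finite (carrier G)" and S: "S \<subseteq> carrier G"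
    and normal: "\<And>s g. s \<in> S \<Longrightarrow> g \<in> carrier G \<Longrightarrow> inv g \<otimes> s \<otimes> g \<in> S"
    and symm: "\<And>s. s \<in> S \<Longrightarrow> inv s \<in> S"
    and orders: "\<And>s. s \<in> S \<Longrightarrow> ord s \<in> {2, 3, 4, 6}"
    and f: "\<forall>x. x \<notin> carrier G \<longrightarrow> f x = 0" "f \<noteq> 0"
    and ev: "\<forall>g\<in>carrier G. (\<Sum>s\<in>S. f (g \<otimes> s)) = k * f g"
  shows "k \<in> \<rat>"
proof -
  \<comment> \<open>The full eigenspace is taken, since translations need not preserve the line
    through \<open>f\<close>.\<close>
  define V where "V = {f :: 'a \<Rightarrow> complex. (\<forall>x. x \<notin> carrier G \<longrightarrow> f x = 0) \<and>
    (\<forall>g\<in>carrier G. (\<Sum>s\<in>S. f (g \<otimes> s)) = k * f g)}"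
  have "fun_space.subspace V"
    unfolding V_def fun_space.subspace_def
    by (auto simp: sum.distrib distrib_left sum_distrib_left[symmetric] mult.left_commute)
  moreover obtain B where B: "B \<subseteq> V" "fun_space.independent B" "V \<subseteq> fun_space.span B"
    by (rule fun_space.maximal_independent_subset)
  ultimately have span: "fun_space.span B = V"
    by (simp add: fun_space.span_subspace)
  have "V \<subseteq> fun_space.span ((\<lambda>a x. if x = a then 1 else 0) ` carrier G)"
    using finitely_supported_subset_span[OF fin] by (auto simp: V_def)
  then have finB: "finite B"
    using fun_space.independent_span_bound[OF _ B(2)] B(1) fin by blast
  \<comment> \<open>Needed for the final division by \<open>card B\<close>.\<close>
  have "B \<noteq> {}"
  proof
    assume "B = {}"
    then have "V = {0}"
      using span by simp
    moreover have "f \<in> V"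
      using f ev by (simp add: V_def)
    ultimately show False
      using f(2) by simp
  qed
  have cancel: "x \<otimes> (inv x \<otimes> y) = y" "inv x \<otimes> (x \<otimes> y) = y"
    if "x \<in> carrier G" "y \<in> carrier G" for x y
    using that by (simp_all flip: m_assoc)
  have trans_V: "right_translation t b \<in> V" if t: "t \<in> carrier G" and b: "b \<in> V" for t b
  proof -
    have "(\<Sum>s\<in>S. right_translation t b (g \<otimes> s)) = k * right_translation t b g"
      if g: "g \<in> carrier G" for g
    proof -
      have "(\<Sum>s\<in>S. right_translation t b (g \<otimes> s)) = (\<Sum>s\<in>S. b (g \<otimes> s \<otimes> t))"
        using S g by (intro sum.cong) (auto simp: right_translation_def)
      \<comment> \<open>Normality enters here: conjugation by \<open>t\<close> permutes
        \<open>S\<close>, and \<open>g \<otimes> s \<otimes> t\<close> equals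
        \<open>g \<otimes> t \<otimes> (inv t \<otimes> s \<otimes> t)\<close>.\<close>
      also have "\<dots> = (\<Sum>s\<in>S. b (g \<otimes> t \<otimes> s))"
      proof (rule sum.reindex_bij_witness[where i = "\<lambda>s. t \<otimes> s \<otimes> inv t" and j = "\<lambda>s. inv t \<otimes> s \<otimes> t"])
        fix s assume s: "s \<in> S"
        then have sc: "s \<in> carrier G"
          using S by blast
        show "inv t \<otimes> s \<otimes> t \<in> S"
          using normal s t by blast
        show "t \<otimes> s \<otimes> inv t \<in> S"
          using normal[OF s, of "inv t"] t by simp
        show "t \<otimes> (inv t \<otimes> s \<otimes> t) \<otimes> inv t = s" "inv t \<otimes> (t \<otimes> s \<otimes> inv t) \<otimes> t = s"
          using sc t by (simp_all add: m_assoc cancel)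
        show "b (g \<otimes> t \<otimes> (inv t \<otimes> s \<otimes> t)) = b (g \<otimes> s \<otimes> t)"
          using sc t g by (simp add: m_assoc cancel)
      qed
      also have "\<dots> = k * right_translation t b g"
        using b t g by (simp add: V_def right_translation_def)
      finally show ?thesis .
    qed
    then show ?thesis
      by (simp add: V_def right_translation_def)
  qed
  define tr where "tr t = (\<Sum>b\<in>B. fun_space.representation B (right_translation t b) b)" for t
  \<comment> \<open>The eigenvalues of a single translation are roots of unity and need not be
    integers; pairing \<open>t\<close> with its inverse makes them integers.\<close>
  have "tr t + tr (inv t) \<in> \<int>" if t: "t \<in> S" for t
  proof -
    have tc: "t \<in> carrier G" "inv t \<in> carrier G"
      using t S by auto
    define T where "T f = right_translation t f + right_translation (inv t) f" for f
    have "Vector_Spaces.linear (\<lambda>c f x. c * f x) (\<lambda>c f x. c * f x) T"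
      by unfold_locales (auto simp: T_def right_translation_def fun_eq_iff algebra_simps)
    moreover have "T b \<in> fun_space.span B" if "b \<in> B" for b
      unfolding T_def using that B(1) tc trans_V
      by (intro fun_space.span_add) (auto simp: span)
    moreover have "c \<in> \<int>" if "v \<in> fun_space.span B" "v \<noteq> 0" "T v = (\<lambda>x. c * v x)" for v c
      using eigenvalue_right_translation_add_inv_in_Ints[of t v c] that tc(1) orders[OF t]
      by (simp add: span V_def T_def)
    ultimately have "(\<Sum>b\<in>B. fun_space.representation B (T b) b) \<in> \<int>"
      by (rule fun_space.trace_on_span_in_Ints[OF B(2) finB])
    also have "(\<Sum>b\<in>B. fun_space.representation B (T b) b) = tr t + tr (inv t)"
      unfolding tr_def T_def sum.distrib[symmetric]
      using B(1) tc trans_V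
      by (intro sum.cong refl) (subst fun_space.representation_add[OF B(2)]; auto simp: span)
    finally show ?thesis .
  qed
  then have "(\<Sum>t\<in>S. tr t + tr (inv t)) \<in> \<int>"
    by (rule Ints_sum)
  also have "(\<Sum>t\<in>S. tr t + tr (inv t)) = 2 * (\<Sum>t\<in>S. tr t)"
  proof -
    \<comment> \<open>Inversion permutes \<open>S\<close> by symmetry.\<close>
    have "(\<Sum>t\<in>S. tr (inv t)) = (\<Sum>t\<in>S. tr t)"
      using S symm by (intro sum.reindex_bij_witness[of _ "\<lambda>s. inv s" "\<lambda>s. inv s"]) auto
    then show ?thesis
      by (simp add: sum.distrib)
  qed
  also have "(\<Sum>t\<in>S. tr t) = (\<Sum>b\<in>B. \<Sum>t\<in>S. fun_space.representation B (right_translation t b) b)"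
    unfolding tr_def by (rule sum.swap)
  also have "\<dots> = (\<Sum>b\<in>B. k)"
  proof (intro sum.cong refl)
    fix b assume b: "b \<in> B"
    have "(\<Sum>t\<in>S. fun_space.representation B (right_translation t b) b)
        = fun_space.representation B (\<Sum>t\<in>S. right_translation t b) b"
      using b B(1) S trans_V by (subst fun_space.representation_sum[OF B(2)]) (auto simp: span)
    \<comment> \<open>On the carrier this is the eigenvalue equation for \<open>b\<close>; elsewhere
      both sides vanish.\<close>
    also have "(\<Sum>t\<in>S. right_translation t b) = (\<lambda>x. k * b x)"
    proof
      fix x
      show "(\<Sum>t\<in>S. right_translation t b) x = k * b x"
        using b B(1) by (cases "x \<in> carrier G") (auto simp: sum_fun_apply right_translation_def V_def)
    qed
    also have "fun_space.representation B (\<lambda>x. k * b x) b = k"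
      using b by (subst fun_space.representation_scale[OF B(2)])
        (auto simp: fun_space.span_base fun_space.representation_basis[OF B(2)])
    finally show "(\<Sum>t\<in>S. fun_space.representation B (right_translation t b) b) = k" .
  qed
  finally have "2 * (of_nat (card B) * k) \<in> \<int>"
    by simp
  then obtain m where "2 * (of_nat (card B) * k) = of_int m"
    by (auto elim: Ints_cases)
  then have "k = of_int m / of_nat (2 * card B)"
    using \<open>B \<noteq> {}\<close> finB by (simp add: field_simps)
  then show ?thesis
    by simp
qed

end

section \<open>From the adjacency matrix to convolution by the connection set\<close>

theorem mainTheorem2:
  fixes G :: "('a, 'b) monoid_scheme" (structure) and S :: "'a set"
  assumes "group G" and "finite (carrier G)"
    and "S \<subseteq> carrier G"
    and normal: "\<forall>s\<in>S. \<forall>g\<in>carrier G. inv g \<otimes> s \<otimes> g \<in> S"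
    and symmetric: "set_inv S = S"
    and orders: "\<forall>s\<in>S. group.ord G s \<in> {2, 3, 4, 6}"
  shows "integral_graph (cayley_graph G S)"
proof -
  interpret group G by fact
  have "k \<in> \<int>"
    if vs: "distinct vs" "set vs = carrier G"
      and k: "eigenvalue (adjacency_matrix vs (cayley_graph G S)) k" for vs k
  proof -
    define n where "n = length vs"
    define A where "A = adjacency_matrix vs (cayley_graph G S)"
    have A: "A \<in> carrier_mat n n"
      by (simp add: A_def adjacency_matrix_def n_def)
    have entry: "A $$ (i, j) = (if vs ! j \<in> (\<lambda>s. vs ! i \<otimes> s) ` S then 1 else 0)"
      if "i < n" "j < n" for i j
    proof -
      have "vs ! i \<in> carrier G"
        using that(1) vs(2) nth_mem n_def by blast
      then have "(vs ! i, vs ! j) \<in> parcs (cayley_graph G S) \<longleftrightarrow> vs ! j \<in> (\<lambda>s. vs ! i \<otimes> s) ` S"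
        unfolding cayley_graph_def by auto
      then show ?thesis
        using that by (simp add: A_def adjacency_matrix_def n_def)
    qed
    have bij: "bij_betw ((!) vs) {..<n} (carrier G)"
      using vs by (auto simp: n_def intro: bij_betw_nth)
    obtain x where x: "x \<in> carrier_vec n" "x \<noteq> 0\<^sub>v n" "A *\<^sub>v x = k \<cdot>\<^sub>v x"
      using k A unfolding A_def[symmetric] by (auto simp: eigenvalue_def eigenvector_def)
    \<comment> \<open>The eigenvector \<open>x\<close> read as a function on the group through the
      enumeration \<open>vs\<close>.\<close>
    define f where "f g = (if g \<in> carrier G then x $ the_inv_into {..<n} ((!) vs) g else 0)" for g
    have f: "f (vs ! i) = x $ i" if "i < n" for i
      using that bij by (auto simp: f_def bij_betw_def the_inv_into_f_f)
    have "(\<Sum>s\<in>S. f (g \<otimes> s)) = k * f g" if g: "g \<in> carrier G" for g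
    proof -
      obtain i where i: "i < n" "g = vs ! i"
        using g vs by (metis in_set_conv_nth n_def)
      \<comment> \<open>Left multiplication by \<open>g\<close> is injective, so summing over
        \<open>S\<close> is summing over the neighbours of \<open>g\<close>, that is, over the
        nonzero entries of row \<open>i\<close>.\<close>
      have "(\<Sum>s\<in>S. f (g \<otimes> s)) = (\<Sum>h\<in>(\<lambda>s. g \<otimes> s) ` S. f h)"
        using assms(3) g by (subst sum.reindex) (auto intro!: inj_onI simp: subset_iff)
      also have "\<dots> = (\<Sum>h\<in>carrier G. if h \<in> (\<lambda>s. g \<otimes> s) ` S then f h else 0)"
        using assms(2,3) g by (intro sum.mono_neutral_cong_left) auto
      also have "\<dots> = (\<Sum>j<n. A $$ (i, j) * x $ j)"
        unfolding sum.reindex_bij_betw[OF bij, symmetric]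
        using i by (intro sum.cong) (auto simp: entry f)
      also have "\<dots> = (A *\<^sub>v x) $ i"
        using i(1) A x(1) by (auto simp: scalar_prod_def lessThan_atLeast0 intro!: sum.cong)
      also have "\<dots> = k * f g"
        using i x f by simp
      finally show ?thesis .
    qed
    moreover have "f \<noteq> 0"
    proof
      assume "f = 0"
      then have "x = 0\<^sub>v n"
        using x(1) f by (intro eq_vecI) force+
      then show False
        using x(2) by contradiction
    qed
    moreover have "inv s \<in> S" if "s \<in> S" for s
      using that symmetric unfolding SET_INV_def by blast
    ultimately have "k \<in> \<rat>"
      using assms(2,3) normal orders
      by (intro convolution_eigenvalue_in_Rats[of S f k]) (auto simp: f_def)
    moreover have "algebraic_int k"
      using k A by (intro algebraic_int_eigenvalue[of A n]) (auto simp: entry A_def[symmetric])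
    ultimately show ?thesis
      by (rule rational_algebraic_int_is_int[rotated])
  qed
  then show ?thesis
    using assms(2) by (auto simp: integral_graph_def cayley_graph_def)
qed

end
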